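(* Let $A$ be a $C^*$-algebra, $\mathcal{H}$ a Hilbert space, $\varphi:A\to L(\mathcal{H})$ a completely positive linear map and $(\pi,\mathcal{H}_\varphi,V_\varphi)$ a minimal Stinespring dilation triple of $\varphi$. Then for every Hilbert $A$-module $X$, every Hilbert space $\mathcal{K}$, every $\pi$-representation $\Pi:X\to L(\mathcal{H}_\varphi,\mathcal{K})$ and every $x\in X$, the following statements are equivalent: (1) $x\in X_\varphi$; (2) $\Pi(x)\left(\mathrm{id}_{\mathcal{H}_\varphi}-V_\varphi V_\varphi^*\right)=0$.
   Context: Hilbert $C^*$-modules are right modules, with inner product linear in the second variable. $L(\mathcal{H},\mathcal{K})$ denotes the bounded linear operators from $\mathcal{H}$ to $\mathcal{K}$, and $L(\mathcal{H})=L(\mathcal{H},\mathcal{H})$; $[\,\cdot\,]$ denotes closed linear span. For a linear map $\psi:A\to L(\mathcal{H})$, a $\psi$-map is a map $\Phi:X\to L(\mathcal{H},\mathcal{K})$ with $\Phi(x)^*\Phi(y)=\psi(\langle x,y\rangle)$ for all $x,y\in X$; when $\psi$ is a $*$-homomorphism it is called a $\psi$-representation. A minimal Stinespring dilation triple (minimal Stinespring representation) of $\varphi$ is a triple $(\pi,\mathcal{H}_\varphi,V_\varphi)$ where $\pi:A\to L(\mathcal{H}_\varphi)$ is a $*$-representation on a Hilbert space, $V_\varphi:\mathcal{H}\to\mathcal{H}_\varphi$ is bounded linear, $\varphi(a)=V_\varphi^*\pi(a)V_\varphi$ for all $a\in A$, and $[\pi(A)V_\varphi\mathcal{H}]=\mathcal{H}_\varphi$.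 Let $M_\varphi=\{a\in A:\varphi(ab)=\varphi(a)\varphi(b),\ \varphi(ba)=\varphi(b)\varphi(a)\ \forall b\in A\}$ and $T_\varphi=\{a\in M_\varphi:\varphi(ba^*c)=\varphi(b)\varphi(a)^*\varphi(c)\ \forall b,c\in A\}$. The ternary domain $X_\varphi$ of $\varphi$ on $X$ is the set $\{x\in X:\Phi(xb)=\Phi(x)\varphi(b)\text{ for all }b\in A\}$, where $\Phi$ is any operator-valued $\varphi$-map on $X$; such maps exist and the set is the same for every choice of $\Phi$ (equivalently $X_\varphi=\{x\in X:\langle x,x\rangle\in T_\varphi\}$). *)

theory Defs
  imports "HOL-Analysis.Analysis" "HOL-Library.Complex_Order"
begin

section \<open>Complex normed spaces, Hilbert spaces and C*-algebras\<close>

class complex_vector = ab_group_add +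
  fixes scaleC :: "complex \<Rightarrow> 'a \<Rightarrow> 'a"  (infixr \<open>*\<^sub>C\<close> 75)
  assumes scaleC_add_right: "c *\<^sub>C (x + y) = c *\<^sub>C x + c *\<^sub>C y"
    and scaleC_add_left: "(c + d) *\<^sub>C x = c *\<^sub>C x + d *\<^sub>C x"
    and scaleC_scaleC: "c *\<^sub>C (d *\<^sub>C x) = (c * d) *\<^sub>C x"
    and scaleC_one: "1 *\<^sub>C x = x"

global_interpretation complex_vector:
  vector_space "scaleC :: complex \<Rightarrow> 'a \<Rightarrow> 'a :: complex_vector"
  by unfold_locales (simp_all add: scaleC_add_right scaleC_add_left scaleC_scaleC scaleC_one)

abbreviation clinear :: "('a::complex_vector \<Rightarrow> 'b::complex_vector) \<Rightarrow> bool"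
  where "clinear \<equiv> Vector_Spaces.linear scaleC scaleC"

lemma clinear_iff:
  fixes T :: "'a::complex_vector \<Rightarrow> 'b::complex_vector"
  shows "clinear T \<longleftrightarrow> (\<forall>x y. T (x + y) = T x + T y) \<and> (\<forall>c x. T (c *\<^sub>C x) = c *\<^sub>C T x)"
  by (simp add: Vector_Spaces.linear_iff complex_vector.vector_space_axioms)

class complex_normed_vector = complex_vector + real_normed_vector +
  assumes scaleR_scaleC: "r *\<^sub>R x = complex_of_real r *\<^sub>C x"
    and norm_scaleC: "norm (c *\<^sub>C x) = cmod c * norm x"

lemma bounded_linear_scaleC_right:
  "bounded_linear (\<lambda>x. c *\<^sub>C x :: 'a::complex_normed_vector)"
  by (rule bounded_linear_intro[where K = "cmod c"])
     (simp_all add: scaleC_add_right scaleR_scaleC scaleC_scaleC norm_scaleC mult.commute)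

class complex_banach = complex_normed_vector + complete_space

text \<open>As for Hilbert modules below, inner products are linear in the second variable.\<close>

class complex_hilbert = complex_banach +
  fixes cinner :: "'a \<Rightarrow> 'a \<Rightarrow> complex"
  assumes cinner_add_right: "cinner x (y + z) = cinner x y + cinner x z"
    and cinner_scaleC_right: "cinner x (c *\<^sub>C y) = c * cinner x y"
    and cinner_commute: "cinner y x = cnj (cinner x y)"
    and cinner_ge_zero: "0 \<le> cinner x x"
    and cinner_eq_zero: "cinner x x = 0 \<Longrightarrow> x = 0"
    and norm_eq_sqrt_cinner: "norm x = sqrt (cmod (cinner x x))"

text \<open>C*-algebras are not assumed to be unital.\<close>

class cstar_algebra = complex_banach + real_normed_algebra +
  fixes star :: "'a \<Rightarrow> 'a"
  assumes mult_scaleC_left: "(c *\<^sub>C a) * b = c *\<^sub>C (a * b)"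
    and mult_scaleC_right: "a * (c *\<^sub>C b) = c *\<^sub>C (a * b)"
    and star_add: "star (a + b) = star a + star b"
    and star_scaleC: "star (c *\<^sub>C a) = cnj c *\<^sub>C star a"
    and star_mult: "star (a * b) = star b * star a"
    and star_star: "star (star a) = a"
    and cstar_identity: "norm (star a * a) = (norm a)\<^sup>2"

definition positive_element :: "'a::cstar_algebra \<Rightarrow> bool"
  where "positive_element a \<longleftrightarrow> (\<exists>b. a = star b * b)"

section \<open>Bounded operators between Hilbert spaces\<close>

typedef (overloaded) ('a, 'b) cblinfun (\<open>(_ \<Rightarrow>\<^sub>C\<^sub>L /_)\<close> [22, 21] 21) =
  "{T :: 'a::complex_normed_vector \<Rightarrow> 'b::complex_normed_vector.
      clinear T \<and> bounded_linear T}"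
  morphisms cblinfun_apply CBlinfun
  by (rule exI[of _ "\<lambda>_. 0"]) (simp add: clinear_iff)

setup_lifting type_definition_cblinfun

instantiation cblinfun :: (complex_normed_vector, complex_normed_vector) complex_vector
begin

lift_definition zero_cblinfun :: "'a \<Rightarrow>\<^sub>C\<^sub>L 'b" is "\<lambda>_. 0"
  by (simp add: clinear_iff)

lift_definition plus_cblinfun :: "'a \<Rightarrow>\<^sub>C\<^sub>L 'b \<Rightarrow> 'a \<Rightarrow>\<^sub>C\<^sub>L 'b \<Rightarrow> 'a \<Rightarrow>\<^sub>C\<^sub>L 'b"
  is "\<lambda>S T x. S x + T x"
  by (auto simp: clinear_iff scaleC_add_right complex_vector.scale_right_diff_distrib intro: bounded_linear_add)

lift_definition minus_cblinfun :: "'a \<Rightarrow>\<^sub>C\<^sub>L 'b \<Rightarrow> 'a \<Rightarrow>\<^sub>C\<^sub>L 'b \<Rightarrow> 'a \<Rightarrow>\<^sub>C\<^sub>L 'b"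
  is "\<lambda>S T x. S x - T x"
  by (auto simp: clinear_iff scaleC_add_right complex_vector.scale_right_diff_distrib intro: bounded_linear_sub)

lift_definition uminus_cblinfun :: "'a \<Rightarrow>\<^sub>C\<^sub>L 'b \<Rightarrow> 'a \<Rightarrow>\<^sub>C\<^sub>L 'b"
  is "\<lambda>T x. - T x"
  by (auto simp: clinear_iff scaleC_add_right complex_vector.scale_right_diff_distrib intro: bounded_linear_minus)

lift_definition scaleC_cblinfun :: "complex \<Rightarrow> 'a \<Rightarrow>\<^sub>C\<^sub>L 'b \<Rightarrow> 'a \<Rightarrow>\<^sub>C\<^sub>L 'b"
  is "\<lambda>c T x. c *\<^sub>C T x"
  by (auto simp: clinear_iff scaleC_add_right complex_vector.scale_right_diff_distrib mult.commute scaleC_scaleC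
      intro: bounded_linear_compose[OF bounded_linear_scaleC_right])

instance
  by standard
     (transfer; simp add: fun_eq_iff scaleC_add_right scaleC_add_left scaleC_scaleC scaleC_one)+

end

lift_definition cblinfun_id :: "'a::complex_normed_vector \<Rightarrow>\<^sub>C\<^sub>L 'a" is "\<lambda>x. x"
  by (auto simp: clinear_iff scaleC_add_right complex_vector.scale_right_diff_distrib intro: bounded_linear_ident)

lift_definition cblinfun_compose ::
  "'b::complex_normed_vector \<Rightarrow>\<^sub>C\<^sub>L 'c::complex_normed_vector \<Rightarrow> 'a::complex_normed_vector \<Rightarrow>\<^sub>C\<^sub>L 'b \<Rightarrow> 'a \<Rightarrow>\<^sub>C\<^sub>L 'c"
  (infixl \<open>o\<^sub>C\<^sub>L\<close> 67) is "\<lambda>S T x. S (T x)"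
  by (auto simp: clinear_iff scaleC_add_right complex_vector.scale_right_diff_distrib intro: bounded_linear_compose)

text \<open>Between Hilbert spaces the adjoint exists and is unique, by the Riesz representation theorem.\<close>

definition cadjoint ::
  "('a::complex_hilbert \<Rightarrow>\<^sub>C\<^sub>L 'b::complex_hilbert) \<Rightarrow> 'b \<Rightarrow>\<^sub>C\<^sub>L 'a"
  where "cadjoint T =
    (THE S. \<forall>x y. cinner (cblinfun_apply T x) y = cinner x (cblinfun_apply S y))"

section \<open>Completely positive maps\<close>

text \<open>
  An \<open>n \<times> n\<close> matrix is a function on index pairs, of which only the entries with indices below
  \<open>n\<close> matter. Positivity over \<open>A\<close> means positivity in the *-algebra \<open>M\<^sub>n(A)\<close>, i.e. being of the
  form \<open>B\<^sup>*B\<close>; matrices over \<open>L(H)\<close> are regarded as operators on \<open>H\<^sup>n\<close>.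
\<close>

definition positive_matrix :: "nat \<Rightarrow> (nat \<Rightarrow> nat \<Rightarrow> 'a::cstar_algebra) \<Rightarrow> bool"
  where "positive_matrix n M \<longleftrightarrow>
    (\<exists>B. \<forall>i<n. \<forall>j<n. M i j = (\<Sum>k<n. star (B k i) * B k j))"

definition positive_operator_matrix ::
  "nat \<Rightarrow> (nat \<Rightarrow> nat \<Rightarrow> 'h::complex_hilbert \<Rightarrow>\<^sub>C\<^sub>L 'h) \<Rightarrow> bool"
  where "positive_operator_matrix n T \<longleftrightarrow>
    (\<forall>\<xi>. 0 \<le> (\<Sum>i<n. \<Sum>j<n. cinner (\<xi> i) (cblinfun_apply (T i j) (\<xi> j))))"

definition completely_positive ::
  "('a::cstar_algebra \<Rightarrow> ('h::complex_hilbert \<Rightarrow>\<^sub>C\<^sub>L 'h)) \<Rightarrow> bool"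
  where "completely_positive \<phi> \<longleftrightarrow> clinear \<phi> \<and>
    (\<forall>n M. positive_matrix n M \<longrightarrow> positive_operator_matrix n (\<lambda>i j. \<phi> (M i j)))"

definition star_representation ::
  "('a::cstar_algebra \<Rightarrow> ('h::complex_hilbert \<Rightarrow>\<^sub>C\<^sub>L 'h)) \<Rightarrow> bool"
  where "star_representation \<pi> \<longleftrightarrow> clinear \<pi> \<and>
    (\<forall>a b. \<pi> (a * b) = \<pi> a o\<^sub>C\<^sub>L \<pi> b) \<and> (\<forall>a. \<pi> (star a) = cadjoint (\<pi> a))"

definition minimal_stinespring_triple ::
  "('a::cstar_algebra \<Rightarrow> ('h::complex_hilbert \<Rightarrow>\<^sub>C\<^sub>L 'h)) \<Rightarrow>
   ('a \<Rightarrow> ('g::complex_hilbert \<Rightarrow>\<^sub>C\<^sub>L 'g)) \<Rightarrow> ('h \<Rightarrow>\<^sub>C\<^sub>L 'g) \<Rightarrow> bool"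
  where "minimal_stinespring_triple \<phi> \<pi> V \<longleftrightarrow> star_representation \<pi> \<and>
    (\<forall>a. \<phi> a = cadjoint V o\<^sub>C\<^sub>L \<pi> a o\<^sub>C\<^sub>L V) \<and>
    closure (complex_vector.span {cblinfun_apply (\<pi> a) (cblinfun_apply V h) | a h. True}) = UNIV"

section \<open>Hilbert modules\<close>

text \<open>
  Completeness in the norm induced by the inner product comes from the class of the module type
  together with \<open>norm_eq\<close>.
\<close>

locale hilbert_module =
  fixes act :: "'x::complex_banach \<Rightarrow> 'a::cstar_algebra \<Rightarrow> 'x"
    and ip :: "'x \<Rightarrow> 'x \<Rightarrow> 'a"
  assumes act_add_left: "act (x + y) a = act x a + act y a"
    and act_add_right: "act x (a + b) = act x a + act x b"
    and act_scaleC_left: "act (c *\<^sub>C x) a = c *\<^sub>C act x a"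
    and act_scaleC_right: "act x (c *\<^sub>C a) = c *\<^sub>C act x a"
    and act_mult: "act x (a * b) = act (act x a) b"
    and ip_add_right: "ip x (y + z) = ip x y + ip x z"
    and ip_scaleC_right: "ip x (c *\<^sub>C y) = c *\<^sub>C ip x y"
    and ip_act_right: "ip x (act y a) = ip x y * a"
    and ip_star: "star (ip x y) = ip y x"
    and ip_positive: "positive_element (ip x x)"
    and ip_eq_zero: "ip x x = 0 \<Longrightarrow> x = 0"
    and norm_eq: "norm x = sqrt (norm (ip x x))"

text \<open>
  \<open>psi_map ip \<psi> \<Phi>\<close> says that \<open>\<Phi>\<close> is a \<open>\<psi>\<close>-map on the module with inner product \<open>ip\<close>; it is called a
  \<open>\<psi>\<close>-representation if \<open>\<psi>\<close> is a *-homomorphism.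
\<close>

definition psi_map ::
  "('x \<Rightarrow> 'x \<Rightarrow> 'a::cstar_algebra) \<Rightarrow> ('a \<Rightarrow> ('h::complex_hilbert \<Rightarrow>\<^sub>C\<^sub>L 'h)) \<Rightarrow>
   ('x \<Rightarrow> ('h \<Rightarrow>\<^sub>C\<^sub>L 'k::complex_hilbert)) \<Rightarrow> bool"
  where "psi_map ip \<psi> \<Phi> \<longleftrightarrow> (\<forall>x y. cadjoint (\<Phi> x) o\<^sub>C\<^sub>L \<Phi> y = \<psi> (ip x y))"

text \<open>
  The ternary domain of \<open>\<phi>\<close>, as computed from a \<open>\<phi>\<close>-map \<open>\<Phi>\<close>. It does not depend on \<open>\<Phi>\<close>, nor on the
  space \<open>K\<close> in which \<open>\<Phi>\<close> takes its values; as a definition cannot quantify over the type of \<open>K\<close>,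
  statements about it are made for an arbitrary \<open>\<phi>\<close>-map \<open>\<Phi>\<close>. Such maps exist: if \<open>\<Psi>\<close> is a
  \<open>\<pi>\<close>-representation for a Stinespring triple \<open>(\<pi>, G, V)\<close> of \<open>\<phi>\<close>, then \<open>\<Psi>(\<cdot>)V\<close> is one.
\<close>

definition ternary_domain ::
  "('x \<Rightarrow> 'a::cstar_algebra \<Rightarrow> 'x) \<Rightarrow> ('a \<Rightarrow> ('h::complex_hilbert \<Rightarrow>\<^sub>C\<^sub>L 'h)) \<Rightarrow>
   ('x \<Rightarrow> ('h \<Rightarrow>\<^sub>C\<^sub>L 'k::complex_hilbert)) \<Rightarrow> 'x set"
  where "ternary_domain act \<phi> \<Phi> = {x. \<forall>b. \<Phi> (act x b) = \<Phi> x o\<^sub>C\<^sub>L \<phi> b}"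

end

theory Submission
  imports Defs
begin

text \<open>
  A \<open>\<phi>\<close>-map \<open>\<Phi>\<close> is determined by \<open>\<phi>\<close> up to an isometry of the closed linear span of the ranges of
  the operators \<open>\<Phi>(y)\<close>, because \<open>\<langle>\<Phi>(y)h, \<Phi>(y')h'\<rangle> = \<langle>h, \<phi>(\<langle>y,y'\<rangle>)h'\<rangle>\<close>. Since \<open>\<Psi>(\<cdot>)V\<close> is a \<open>\<phi>\<close>-map as well
  (\<open>psi_map_compress\<close>), the condition \<open>\<Phi>(xb)h = \<Phi>(x)\<phi>(b)h\<close> defining the ternary domain may be tested
  on \<open>\<Psi>(\<cdot>)V\<close> in place of \<open>\<Phi>\<close> (\<open>ternary_domain_independent\<close>). The \<open>\<pi>\<close>-representation
  \<open>\<Psi>\<close> automatically intertwines the module action, \<open>\<Psi>(xb) = \<Psi>(x)\<pi>(b)\<close> (\<open>psi_map_act\<close>), and with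
  \<open>\<phi>(b) = V\<^sup>*\<pi>(b)V\<close> the condition becomes
  \<open>\<Psi>(x)(1 - VV\<^sup>*)\<pi>(b)Vh = 0\<close> for all \<open>b\<close> and \<open>h\<close>.
  By minimality of the dilation the vectors \<open>\<pi>(b)Vh\<close> have dense span, so this says that
  \<open>\<Psi>(x)(1 - VV\<^sup>*) = 0\<close>.

  The adjoint is a definite description, so its defining property has to be earned from the Riesz
  representation theorem (\<open>riesz_representation\<close>), which rests on minimizing the functional
  \<open>\<parallel>x\<parallel>\<^sup>2 - 2 Re f(x)\<close>.
\<close>

section \<open>Inner products\<close>

lemma cinner_add_left: "cinner (x + y) z = cinner x z + cinner (y::'a::complex_hilbert) z"
  by (simp add: cinner_commute[of _ z] cinner_add_right)

lemma cinner_scaleC_left: "cinner (c *\<^sub>C x) y = cnj c * cinner x (y::'a::complex_hilbert)"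
  by (simp add: cinner_commute[of _ y] cinner_scaleC_right)

lemma cinner_diff_right: "cinner x (y - z) = cinner x y - cinner x (z::'a::complex_hilbert)"
  using cinner_add_right[of x "y - z" z] by simp

lemma cinner_diff_left: "cinner (x - y) z = cinner x z - cinner (y::'a::complex_hilbert) z"
  using cinner_add_left[of "x - y" y z] by simp

lemma cinner_self: "cinner x x = complex_of_real ((norm (x::'a::complex_hilbert))\<^sup>2)"
  using cinner_ge_zero[of x]
  by (simp add: norm_eq_sqrt_cinner less_eq_complex_def complex_eq_iff cmod_eq_Re)

lemma norm_add_square:
  "(norm (x + y))\<^sup>2 = (norm x)\<^sup>2 + (norm y)\<^sup>2 + 2 * Re (cinner x (y::'a::complex_hilbert))"
proof -
  have "complex_of_real ((norm (x + y))\<^sup>2) =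
      of_real ((norm x)\<^sup>2) + of_real ((norm y)\<^sup>2) + (cinner x y + cnj (cinner x y))"
    by (simp only: cinner_self[symmetric] cinner_add_left cinner_add_right
        cinner_commute[of y x] algebra_simps)
  then show ?thesis
    by (simp add: complex_eq_iff)
qed

text \<open>
  The norm satisfies the triangle inequality by hypothesis, and squaring that inequality
  bounds the real part of the inner product; a rotation of one argument does the rest.
\<close>

lemma cinner_bound: "cmod (cinner x y) \<le> norm x * norm (y::'a::complex_hilbert)"
proof -
  have Re_le: "Re (cinner u v) \<le> norm u * norm v" for u v :: 'a
  proof -
    have "(norm (u + v))\<^sup>2 \<le> (norm u + norm v)\<^sup>2"
      by (simp add: norm_triangle_ineq power_mono)
    then show ?thesis
      by (simp add: norm_add_square power2_sum)
  qed
  define c where "c = cnj (sgn (cinner x y))"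
  have "c * cinner x y = of_real (cmod (cinner x y))"
  proof (cases "cinner x y = 0")
    case False
    have "c * cinner x y = cinner x y * cnj (cinner x y) / of_real (cmod (cinner x y))"
      by (simp add: c_def sgn_eq)
    also have "\<dots> = (of_real (cmod (cinner x y)))\<^sup>2 / of_real (cmod (cinner x y))"
      by (simp only: complex_norm_square[symmetric] of_real_power)
    also have "\<dots> = of_real (cmod (cinner x y))"
      using False by (simp add: power2_eq_square)
    finally show ?thesis .
  qed simp
  then have "cmod (cinner x y) = Re (cinner x (c *\<^sub>C y))"
    by (simp add: cinner_scaleC_right)
  also have "\<dots> \<le> norm x * norm (c *\<^sub>C y)"
    by (rule Re_le)
  also have "\<dots> \<le> norm x * norm y"
    by (auto simp: norm_scaleC c_def norm_sgn)
  finally show ?thesis .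
qed

text \<open>The entries of the Gram matrix of \<open>u\<close> and \<open>v\<close> determine \<open>\<parallel>u - v\<parallel>\<close>.\<close>

lemma eq_iff_eq_if_same_gram:
  fixes u v :: "'a::complex_hilbert" and u' v' :: "'b::complex_hilbert"
  assumes "cinner u u = cinner u' u'" "cinner u v = cinner u' v'" "cinner v v = cinner v' v'"
  shows "u = v \<longleftrightarrow> u' = v'"
proof -
  have "cinner v u = cinner v' u'"
    by (simp add: cinner_commute[of v] cinner_commute[of v'] assms(2))
  then have "cinner (u - v) (u - v) = cinner (u' - v') (u' - v')"
    using assms by (simp add: cinner_diff_left cinner_diff_right)
  then have "norm (u - v) = norm (u' - v')"
    by (simp add: norm_eq_sqrt_cinner)
  then show ?thesis
    by (metis norm_eq_zero right_minus_eq)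
qed

lemma cinner_extensionality:
  assumes "\<And>w. cinner u w = cinner (v::'a::complex_hilbert) w"
  shows "u = v"
proof -
  have "cinner u u = cinner v v"
    by (metis assms cinner_commute)
  then show ?thesis
    using eq_iff_eq_if_same_gram[of u v v v] assms by simp
qed

section \<open>The Riesz representation theorem and adjoints\<close>

text \<open>
  The vector representing \<open>f\<close> is the minimizer of \<open>J(x) = \<parallel>x\<parallel>\<^sup>2 - 2 Re f(x)\<close>. The functional is
  bounded below because \<open>f\<close> is bounded. By the parallelogram law,
  \<open>\<parallel>x - y\<parallel>\<^sup>2 = 2 J(x) + 2 J(y) - 4 J((x + y)/2)\<close>, so minimizing sequences are Cauchy. At a
  minimizer \<open>z\<close> the first variation \<open>2 Re (\<langle>z,w\<rangle> - f(w))\<close> vanishes in each direction \<open>w\<close>.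
\<close>

lemma riesz_representation:
  fixes f :: "'a::complex_hilbert \<Rightarrow> complex"
  assumes add: "\<And>x y. f (x + y) = f x + f y"
    and scale: "\<And>c x. f (c *\<^sub>C x) = c * f x"
    and bound: "\<And>x. cmod (f x) \<le> K * norm x"
  shows "\<exists>z. \<forall>w. f w = cinner z w"
proof -
  define J where "J x = (norm x)\<^sup>2 - 2 * Re (f x)" for x
  define m where "m = Inf (range J)"
  have fR: "f (r *\<^sub>R x) = of_real r * f x" for r x
    by (simp add: scaleR_scaleC scale)
  have lower: "- K\<^sup>2 \<le> J x" for x
  proof -
    have "Re (f x) \<le> K * norm x"
      using complex_Re_le_cmod bound order_trans by blast
    moreover have "0 \<le> (norm x - K)\<^sup>2"
      by simp
    ultimately show ?thesis
      unfolding J_def power2_diff by (simp add: algebra_simps)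
  qed
  then have m_le: "m \<le> J x" for x
    unfolding m_def by (intro cInf_lower bdd_belowI[of _ "- K\<^sup>2"]) auto
  have J_add: "J (x + y) = J x + (norm y)\<^sup>2 + 2 * (Re (cinner x y) - Re (f y))" for x y
    by (simp add: J_def norm_add_square add)
  have parallelogram: "(norm (y - x))\<^sup>2 = 2 * J x + 2 * J y - 4 * J (x + (1/2) *\<^sub>R (y - x))" for x y
  proof -
    define w where "w = (1/2) *\<^sub>R (y - x)"
    define d where "d = Re (cinner x (y - x)) - Re (f (y - x))"
    have "Re (cinner x w) - Re (f w) = d / 2"
      unfolding d_def by (simp only: w_def scaleR_scaleC cinner_scaleC_right scale) simp
    moreover have "(norm w)\<^sup>2 = (norm (y - x))\<^sup>2 / 4"
      by (simp add: w_def power2_eq_square)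
    ultimately have "J (x + w) = J x + (norm (y - x))\<^sup>2 / 4 + d"
      by (simp add: J_add)
    moreover have "J y = J x + (norm (y - x))\<^sup>2 + 2 * d"
      using J_add[of x "y - x"] by (simp add: d_def)
    ultimately show ?thesis
      unfolding w_def[symmetric] by simp
  qed
  have "\<exists>x. J x < m + inverse (real (Suc n))" for n
  proof -
    have "Inf (range J) < m + inverse (real (Suc n))"
      by (simp add: m_def)
    then show ?thesis
      using cInf_lessD[of "range J"] by auto
  qed
  then obtain s where s: "J (s n) < m + inverse (real (Suc n))" for n
    by metis
  have "Cauchy s"
  proof (rule metric_CauchyI)
    fix e :: real assume "0 < e"
    then obtain N where N: "inverse (real (Suc N)) < e\<^sup>2 / 4"
      using reals_Archimedean[of "e\<^sup>2 / 4"] by auto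
    have tail: "J (s n) < m + e\<^sup>2 / 4" if "N \<le> n" for n
    proof -
      have "inverse (real (Suc n)) \<le> inverse (real (Suc N))"
        using that by (simp add: le_imp_inverse_le)
      then show ?thesis
        using s[of n] N by linarith
    qed
    have "dist (s p) (s q) < e" if "N \<le> p" "N \<le> q" for p q
    proof -
      have "(norm (s p - s q))\<^sup>2 < e\<^sup>2"
        using parallelogram[where x="s q" and y="s p"] tail[OF that(1)] tail[OF that(2)]
          m_le[of "s q + (1/2) *\<^sub>R (s p - s q)"] by linarith
      then show ?thesis
        using \<open>0 < e\<close> by (simp add: dist_norm power_less_imp_less_base)
    qed
    then show "\<exists>N. \<forall>p\<ge>N. \<forall>q\<ge>N. dist (s p) (s q) < e"
      by blast
  qed
  then obtain z where z: "s \<longlonglongrightarrow> z"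
    using Cauchy_convergent convergent_def by blast
  have "bounded_linear f"
    by (rule bounded_linear_intro[where K = K])
      (use bound in \<open>auto simp: add fR scaleR_conv_of_real mult.commute\<close>)
  then have "(\<lambda>n. J (s n)) \<longlonglongrightarrow> J z"
    unfolding J_def by (intro tendsto_intros z bounded_linear.tendsto[of f])
  moreover have "(\<lambda>n. m + inverse (real (Suc n))) \<longlonglongrightarrow> m"
    using tendsto_add[OF tendsto_const LIMSEQ_inverse_real_of_nat] by simp
  ultimately have "J z \<le> m"
    by (rule LIMSEQ_le) (use s less_imp_le in blast)
  have Re_eq: "Re (f w) = Re (cinner z w)" for w
  proof -
    define d where "d = Re (cinner z w) - Re (f w)"
    define n where "n = (norm w)\<^sup>2"
    \<comment> \<open>For \<open>w \<noteq> 0\<close> the minimum of \<open>J(z + tw)\<close> over \<open>t\<close> is at \<open>- d / n\<close>; the \<open>1\<close> added to the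
      denominator covers \<open>w = 0\<close>.\<close>
    define t where "t = - d / (n + 1)"
    have "0 \<le> n"
      by (simp add: n_def)
    have "J z \<le> J (z + t *\<^sub>R w)"
      using \<open>J z \<le> m\<close> m_le order_trans by blast
    then have "0 \<le> t\<^sup>2 * n + 2 * t * d"
      unfolding J_add d_def n_def
      by (simp add: power_mult_distrib fR scaleR_scaleC cinner_scaleC_right norm_scaleC scale
          algebra_simps)
    moreover have "d = - (t * (n + 1))"
      using \<open>0 \<le> n\<close> by (simp add: t_def)
    ultimately have "t\<^sup>2 * (n + 2) \<le> 0"
      by (simp add: power2_eq_square algebra_simps)
    then have "t = 0"
      using \<open>0 \<le> n\<close> by (simp add: mult_le_0_iff)
    then have "d = 0"
      using \<open>d = - (t * (n + 1))\<close> by simp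
    then show ?thesis
      by (simp add: d_def)
  qed
  \<comment> \<open>The imaginary part at \<open>w\<close> is, up to sign, the real part at \<open>\<i>w\<close>.\<close>
  have "f w = cinner z w" for w
    using Re_eq[of w] Re_eq[of "\<i> *\<^sub>C w"]
    by (simp add: scale cinner_scaleC_right complex_eq_iff)
  then show ?thesis
    by blast
qed

lemma cblinfun_clinear:
  "cblinfun_apply T (x + y) = cblinfun_apply T x + cblinfun_apply T y"
  "cblinfun_apply T (c *\<^sub>C x) = c *\<^sub>C cblinfun_apply T x"
  using cblinfun_apply[of T] by (auto simp: clinear_iff)

lemma cblinfun_bounded_linear: "bounded_linear (cblinfun_apply T)"
  using cblinfun_apply[of T] by auto

lemma cblinfun_eq_iff: "S = T \<longleftrightarrow> (\<forall>x. cblinfun_apply S x = cblinfun_apply T x)"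
  by (metis cblinfun_apply_inject ext)

lemma cadjoint_exists:
  fixes T :: "'a::complex_hilbert \<Rightarrow>\<^sub>C\<^sub>L 'b::complex_hilbert"
  shows "\<exists>S. \<forall>x y. cinner (cblinfun_apply T x) y = cinner x (cblinfun_apply S y)"
proof -
  obtain K where "0 \<le> K" and K: "norm (cblinfun_apply T x) \<le> norm x * K" for x
    using bounded_linear.nonneg_bounded[OF cblinfun_bounded_linear] by blast
  have "\<exists>z. \<forall>x. cinner y (cblinfun_apply T x) = cinner z x" for y
  proof (rule riesz_representation[where K = "norm y * K"])
    fix x
    have "cmod (cinner y (cblinfun_apply T x)) \<le> norm y * norm (cblinfun_apply T x)"
      by (rule cinner_bound)
    also have "\<dots> \<le> norm y * (norm x * K)"
      by (intro mult_left_mono K) simp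
    finally show "cmod (cinner y (cblinfun_apply T x)) \<le> norm y * K * norm x"
      by (simp add: mult_ac)
  qed (simp_all add: cblinfun_clinear cinner_add_right cinner_scaleC_right)
  then obtain S where S: "cinner y (cblinfun_apply T x) = cinner (S y) x" for x y
    by metis
  have S_add: "S (u + v) = S u + S v" for u v
    by (rule cinner_extensionality) (simp add: cinner_add_left flip: S)
  have S_scale: "S (c *\<^sub>C u) = c *\<^sub>C S u" for c u
    by (rule cinner_extensionality) (simp add: cinner_scaleC_left flip: S)
  \<comment> \<open>\<open>\<parallel>Su\<parallel>\<^sup>2 = \<langle>u, TSu\<rangle> \<le> \<parallel>u\<parallel> K \<parallel>Su\<parallel>\<close>.\<close>
  have S_bound: "norm (S u) \<le> norm u * K" for u
  proof (cases "S u = 0")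
    case False
    have "norm (S u) * norm (S u) = cmod (cinner (S u) (S u))"
      by (simp add: cinner_self norm_power power2_eq_square norm_mult)
    also have "\<dots> = cmod (cinner u (cblinfun_apply T (S u)))"
      by (simp add: S)
    also have "\<dots> \<le> norm u * norm (cblinfun_apply T (S u))"
      by (rule cinner_bound)
    also have "\<dots> \<le> norm u * (norm (S u) * K)"
      by (intro mult_left_mono K) simp
    finally have "norm (S u) * norm (S u) \<le> (norm u * K) * norm (S u)"
      by (simp add: mult_ac)
    then show ?thesis
      using False by simp
  qed (simp add: \<open>0 \<le> K\<close>)
  have "bounded_linear S"
    by (rule bounded_linear_intro[where K = K])
      (simp_all add: S_add S_scale S_bound scaleR_scaleC)
  then have "cblinfun_apply (CBlinfun S) = S"
    by (simp add: CBlinfun_inverse clinear_iff S_add S_scale)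
  moreover have "cinner (cblinfun_apply T x) y = cinner x (S y)" for x y
    using S cinner_commute by metis
  ultimately show ?thesis
    by metis
qed

lemma cadjoint_unique:
  assumes "\<And>x y. cinner x (cblinfun_apply S y) = cinner x (cblinfun_apply S' y)"
  shows "S = (S' :: 'b::complex_hilbert \<Rightarrow>\<^sub>C\<^sub>L 'a::complex_hilbert)"
  unfolding cblinfun_eq_iff
proof
  fix y
  show "cblinfun_apply S y = cblinfun_apply S' y"
    by (rule cinner_extensionality, subst (1 2) cinner_commute) (simp only: assms)
qed

lemma cinner_cadjoint:
  "cinner x (cblinfun_apply (cadjoint T) y) = cinner (cblinfun_apply T x) y"
proof -
  have "\<exists>!S. \<forall>x y. cinner (cblinfun_apply T x) y = cinner x (cblinfun_apply S y)"
    using cadjoint_exists[of T] by (auto intro: cadjoint_unique)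
  from theI'[OF this, folded cadjoint_def] show ?thesis
    by metis
qed

section \<open>Module maps and ternary domains\<close>

lemma cblinfun_compose_apply [simp]:
  "cblinfun_apply (S o\<^sub>C\<^sub>L T) x = cblinfun_apply S (cblinfun_apply T x)"
  by transfer simp

text \<open>The kernel of a bounded operator is a closed subspace.\<close>

lemma cblinfun_eq_0_on_dense_span:
  assumes "closure (complex_vector.span D) = UNIV" and "\<And>d. d \<in> D \<Longrightarrow> cblinfun_apply T d = 0"
  shows "T = 0"
proof -
  have "complex_vector.span D \<subseteq> {g. cblinfun_apply T g = 0}"
    using assms(2)
    by (intro complex_vector.span_minimal complex_vector.subspaceI)
      (auto simp: cblinfun_clinear linear_0
        bounded_linear.linear[OF cblinfun_bounded_linear])
  moreover have "closed {g. cblinfun_apply T g = 0}"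
    by (intro closed_Collect_eq continuous_on_const
        linear_continuous_on cblinfun_bounded_linear)
  ultimately have "{g. cblinfun_apply T g = 0} = UNIV"
    using assms(1) closure_minimal by blast
  then show ?thesis
    by (auto simp: cblinfun_eq_iff zero_cblinfun.rep_eq)
qed

lemma psi_map_cinner:
  assumes "psi_map ip \<psi> \<Phi>"
  shows "cinner (cblinfun_apply (\<Phi> x) g) (cblinfun_apply (\<Phi> y) h) =
    cinner g (cblinfun_apply (\<psi> (ip x y)) h)"
  using assms by (metis psi_map_def cinner_cadjoint cblinfun_compose_apply)

lemma psi_mapI:
  assumes "\<And>x y g h. cinner (cblinfun_apply (\<Phi> x) g) (cblinfun_apply (\<Phi> y) h) =
    cinner g (cblinfun_apply (\<psi> (ip x y)) h)"
  shows "psi_map ip \<psi> \<Phi>"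
  unfolding psi_map_def using assms by (auto intro!: cadjoint_unique simp: cinner_cadjoint)

lemma psi_map_compress:
  assumes "psi_map ip \<pi> \<Psi>" and "\<And>a. \<phi> a = cadjoint V o\<^sub>C\<^sub>L \<pi> a o\<^sub>C\<^sub>L V"
  shows "psi_map ip \<phi> (\<lambda>y. \<Psi> y o\<^sub>C\<^sub>L V)"
  by (rule psi_mapI) (simp add: psi_map_cinner[OF assms(1)] assms(2) cinner_cadjoint)

text \<open>
  The Gram matrix of \<open>\<Phi>(xb)h\<close> and \<open>\<Phi>(x)\<phi>(b)h\<close> is expressed by \<open>\<phi>\<close> and the inner product of the
  module alone.
\<close>

lemma ternary_domain_independent:
  assumes "psi_map ip \<phi> \<Phi>" and "psi_map ip \<phi> \<Phi>'"
  shows "ternary_domain act \<phi> \<Phi> = ternary_domain act \<phi> \<Phi>'"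
proof -
  have "cblinfun_apply (\<Phi> (act x b)) h = cblinfun_apply (\<Phi> x) (cblinfun_apply (\<phi> b) h) \<longleftrightarrow>
      cblinfun_apply (\<Phi>' (act x b)) h = cblinfun_apply (\<Phi>' x) (cblinfun_apply (\<phi> b) h)" for x b h
    by (rule eq_iff_eq_if_same_gram)
      (simp_all add: psi_map_cinner[OF assms(1)] psi_map_cinner[OF assms(2)])
  then show ?thesis
    by (simp add: ternary_domain_def cblinfun_eq_iff)
qed

text \<open>
  Multiplicativity of \<open>\<pi>\<close> makes all entries of the Gram matrix of \<open>\<Psi>(xb)g\<close> and \<open>\<Psi>(x)\<pi>(b)g\<close>
  equal to \<open>\<langle>g, \<pi>(b\<^sup>*\<langle>x,x\<rangle>b)g\<rangle>\<close>.
\<close>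

lemma psi_map_act:
  assumes "hilbert_module act ip" and "star_representation \<pi>" and "psi_map ip \<pi> \<Psi>"
  shows "\<Psi> (act x b) = \<Psi> x o\<^sub>C\<^sub>L \<pi> b"
proof -
  interpret hilbert_module act ip
    by (rule assms(1))
  have ip_act_left: "ip (act x b) y = star b * ip x y" for y
    by (metis ip_act_right ip_star star_mult)
  have mult: "\<pi> (a * c) = \<pi> a o\<^sub>C\<^sub>L \<pi> c" and adj: "\<pi> (star a) = cadjoint (\<pi> a)" for a c
    using assms(2) by (auto simp: star_representation_def)
  have "cblinfun_apply (\<Psi> (act x b)) g = cblinfun_apply (\<Psi> x) (cblinfun_apply (\<pi> b) g)"
    (is "?u = ?v") for g
  proof -
    \<comment> \<open>The pair \<open>(u, v)\<close> has the Gram matrix of the pair \<open>(v, v)\<close>.\<close>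
    have "?u = ?v \<longleftrightarrow> ?v = ?v"
      by (rule eq_iff_eq_if_same_gram)
        (simp_all add: psi_map_cinner[OF assms(3)] ip_act_left ip_act_right mult adj
          cinner_cadjoint)
    then show ?thesis
      by simp
  qed
  then show ?thesis
    by (simp add: cblinfun_eq_iff)
qed

theorem theorem4p3:
  fixes \<phi> :: "'a::cstar_algebra \<Rightarrow> ('h::complex_hilbert \<Rightarrow>\<^sub>C\<^sub>L 'h)"
    and \<pi> :: "'a \<Rightarrow> ('g::complex_hilbert \<Rightarrow>\<^sub>C\<^sub>L 'g)"
    and V :: "'h \<Rightarrow>\<^sub>C\<^sub>L 'g"
    and act :: "'x::complex_banach \<Rightarrow> 'a \<Rightarrow> 'x"
    and ip :: "'x \<Rightarrow> 'x \<Rightarrow> 'a"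
    and \<Psi> :: "'x \<Rightarrow> ('g \<Rightarrow>\<^sub>C\<^sub>L 'k::complex_hilbert)"
    and \<Phi> :: "'x \<Rightarrow> ('h \<Rightarrow>\<^sub>C\<^sub>L 'l::complex_hilbert)"
    and x :: 'x
  assumes "completely_positive \<phi>"
    and "minimal_stinespring_triple \<phi> \<pi> V"
    and "hilbert_module act ip"
    and "psi_map ip \<pi> \<Psi>"
    and "psi_map ip \<phi> \<Phi>"
  shows "x \<in> ternary_domain act \<phi> \<Phi> \<longleftrightarrow>
    \<Psi> x o\<^sub>C\<^sub>L (cblinfun_id - V o\<^sub>C\<^sub>L cadjoint V) = 0"
proof -
  let ?D = "{cblinfun_apply (\<pi> a) (cblinfun_apply V h) | a h. True}"
  let ?Q = "\<Psi> x o\<^sub>C\<^sub>L (cblinfun_id - V o\<^sub>C\<^sub>L cadjoint V)"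
  have rep: "star_representation \<pi>"
    and dilation: "\<And>a. \<phi> a = cadjoint V o\<^sub>C\<^sub>L \<pi> a o\<^sub>C\<^sub>L V"
    and dense: "closure (complex_vector.span ?D) = UNIV"
    using assms(2) by (auto simp: minimal_stinespring_triple_def)
  have Q: "cblinfun_apply ?Q g =
      cblinfun_apply (\<Psi> x) g -
      cblinfun_apply (\<Psi> x) (cblinfun_apply V (cblinfun_apply (cadjoint V) g))" for g
    by (simp add: minus_cblinfun.rep_eq cblinfun_id.rep_eq
        linear_diff bounded_linear.linear[OF cblinfun_bounded_linear])
  have "x \<in> ternary_domain act \<phi> \<Phi> \<longleftrightarrow> x \<in> ternary_domain act \<phi> (\<lambda>y. \<Psi> y o\<^sub>C\<^sub>L V)"
    using ternary_domain_independent[OF assms(5) psi_map_compress[OF assms(4) dilation]] by simp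
  also have "\<dots> \<longleftrightarrow> (\<forall>d\<in>?D. cblinfun_apply ?Q d = 0)"
    by (auto simp: ternary_domain_def cblinfun_eq_iff psi_map_act[OF assms(3) rep assms(4)]
        dilation Q simp del: cblinfun_compose_apply) (auto)
  also have "\<dots> \<longleftrightarrow> ?Q = 0"
  proof
    assume "\<forall>d\<in>?D. cblinfun_apply ?Q d = 0"
    then show "?Q = 0"
      by (intro cblinfun_eq_0_on_dense_span[OF dense]) blast
  next
    assume "?Q = 0"
    then show "\<forall>d\<in>?D. cblinfun_apply ?Q d = 0"
      by (simp only: zero_cblinfun.rep_eq) simp
  qed
  finally show ?thesis .
qed

end
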